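(* For $A=e^{i\theta}$ with $\theta\in\mathbb{R}$, let $R:\mathbb{C}^2\otimes\mathbb{C}^2\to\mathbb{C}^2\otimes\mathbb{C}^2$ be the unitary operator given in the ordered basis $|00\rangle,|01\rangle,|10\rangle,|11\rangle$ by $$R=\begin{pmatrix} 0 & 0 & 0 & A \\ 0 & A^{-1} & 0 & 0 \\ 0 & 0 & A^{-1} & 0 \\ A & 0 & 0 & 0 \end{pmatrix}.$$ If $\sin(2\theta)\neq 0$, then $R$ is entangling. Consequently there is a continuum of values $A$ on the unit circle for which $R$ is entangling.
   Context: Let $V=\mathbb{C}^2$ with orthonormal basis $|0\rangle,|1\rangle$. A unitary map $R:V\otimes V\to V\otimes V$ is entangling if there are $|\alpha\rangle,|\beta\rangle\in V$ such that $R(|\alpha\rangle\otimes|\beta\rangle)$ is not of the form $|\alpha'\rangle\otimes|\beta'\rangle$ with $|\alpha'\rangle,|\beta'\rangle\in V$. *)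

theory Defs
  imports "HOL-Analysis.Analysis" "HOL-Library.Equipollence"
begin

text \<open>
  \<open>V = complex ^ 2\<close>, with coordinates indexed by the elements \<open>0\<close>, \<open>1\<close> of the two-element type
  \<open>2\<close> (the numeral \<open>2 :: 2\<close> is another name of \<open>0\<close>).  The tensor square of \<open>V\<close> is
  \<open>complex ^ (2 \<times> 2)\<close>, where the coordinate \<open>(i, j)\<close> belongs to \<open>ket i \<otimes> ket j\<close>.
\<close>

type_synonym qubit = "complex ^ 2"
type_synonym qubit2 = "complex ^ (2 \<times> 2)"

definition ket :: "2 \<Rightarrow> qubit" where
  "ket i = axis i 1"

definition tensor :: "qubit \<Rightarrow> qubit \<Rightarrow> qubit2" where
  "tensor \<alpha> \<beta> = (\<chi> p. \<alpha> $ fst p * \<beta> $ snd p)"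

text \<open>The library's inner product on \<open>complex ^ 'n\<close> is real valued, so the Hermitian one is
  introduced here; it makes the vectors \<open>axis i 1\<close> orthonormal.\<close>

definition hermitian_inner :: "complex ^ 'n \<Rightarrow> complex ^ 'n \<Rightarrow> complex" where
  "hermitian_inner u v = (\<Sum>i\<in>UNIV. cnj (u $ i) * v $ i)"

definition unitary_map :: "(complex ^ 'n \<Rightarrow> complex ^ 'n) \<Rightarrow> bool" where
  "unitary_map U \<longleftrightarrow>
     Vector_Spaces.linear (*s) (*s) U \<and> surj U \<and>
     (\<forall>u v. hermitian_inner (U u) (U v) = hermitian_inner u v)"

definition entangling :: "(qubit2 \<Rightarrow> qubit2) \<Rightarrow> bool" where
  "entangling U \<longleftrightarrow>
     (\<exists>\<alpha> \<beta>. \<not> (\<exists>\<alpha>' \<beta>'. U (tensor \<alpha> \<beta>) = tensor \<alpha>' \<beta>'))"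

text \<open>The ordered basis 00, 01, 10, 11.  Rows and columns of a matrix of type
  \<open>complex ^ 4 ^ 4\<close> are numbered \<open>1, 2, 3, 4\<close> by \<open>vector\<close>.\<close>

definition basis_position :: "2 \<times> 2 \<Rightarrow> 4" where
  "basis_position p =
     (if p = (0, 0) then 1 else if p = (0, 1) then 2 else if p = (1, 0) then 3 else 4)"

definition operator_of_matrix :: "complex ^ 4 ^ 4 \<Rightarrow> qubit2 \<Rightarrow> qubit2" where
  "operator_of_matrix M v =
     (\<chi> p. \<Sum>q\<in>UNIV. M $ basis_position p $ basis_position q * v $ q)"

definition R_matrix :: "complex \<Rightarrow> complex ^ 4 ^ 4" where
  "R_matrix A = vector
     [vector [0, 0,         0,         A],
      vector [0, inverse A, 0,         0],
      vector [0, 0,         inverse A, 0],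
      vector [A, 0,         0,         0]]"

definition R_op :: "complex \<Rightarrow> qubit2 \<Rightarrow> qubit2" where
  "R_op A = operator_of_matrix (R_matrix A)"

lemma tensor_ket: "tensor (ket i) (ket j) = axis (i, j) 1"
  by (auto simp: tensor_def ket_def axis_def vec_eq_iff)

lemma R_op_nth:
  "R_op A v $ (0, 0) = A * v $ (1, 1)"
  "R_op A v $ (0, 1) = inverse A * v $ (0, 1)"
  "R_op A v $ (1, 0) = inverse A * v $ (1, 0)"
  "R_op A v $ (1, 1) = A * v $ (0, 0)"
proof -
  have two: "(UNIV :: 2 set) = {0, 1}"
    using exhaust_2 by fastforce
  have U: "(UNIV :: (2 \<times> 2) set) = {(0, 0), (0, 1), (1, 0), (1, 1)}"
    unfolding UNIV_Times_UNIV[symmetric] two by auto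
  show
    "R_op A v $ (0, 0) = A * v $ (1, 1)"
    "R_op A v $ (0, 1) = inverse A * v $ (0, 1)"
    "R_op A v $ (1, 0) = inverse A * v $ (1, 0)"
    "R_op A v $ (1, 1) = A * v $ (0, 0)"
    by (simp_all add: R_op_def operator_of_matrix_def R_matrix_def basis_position_def U vector_def)
qed

lemma R_op_ket:
  "R_op A (tensor (ket 0) (ket 0)) = A *s tensor (ket 1) (ket 1)"
  "R_op A (tensor (ket 0) (ket 1)) = inverse A *s tensor (ket 0) (ket 1)"
  "R_op A (tensor (ket 1) (ket 0)) = inverse A *s tensor (ket 1) (ket 0)"
  "R_op A (tensor (ket 1) (ket 1)) = A *s tensor (ket 0) (ket 0)"
proof -
  have two: "(\<forall>i :: 2. P i) \<longleftrightarrow> P 0 \<and> P 1" for P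
    using exhaust_2 by (metis (full_types) forall_2 zero_neq_one)
  show
    "R_op A (tensor (ket 0) (ket 0)) = A *s tensor (ket 1) (ket 1)"
    "R_op A (tensor (ket 0) (ket 1)) = inverse A *s tensor (ket 0) (ket 1)"
    "R_op A (tensor (ket 1) (ket 0)) = inverse A *s tensor (ket 1) (ket 0)"
    "R_op A (tensor (ket 1) (ket 1)) = A *s tensor (ket 0) (ket 0)"
    by (simp_all add: vec_eq_iff split_paired_All two R_op_nth tensor_ket axis_def)
qed

end

theory Submission
  imports Defs
begin

text \<open>
  A product vector \<open>v = \<alpha> \<otimes> \<beta>\<close> satisfies \<open>v\<^sub>0\<^sub>0 v\<^sub>1\<^sub>1 = v\<^sub>0\<^sub>1 v\<^sub>1\<^sub>0\<close>, since both sides are the product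
  of all four coordinates of \<open>\<alpha>\<close> and \<open>\<beta>\<close>.  The product of two copies of \<open>|0\<rangle> + |1\<rangle>\<close> has all
  coordinates \<open>1\<close>, so \<open>R\<close> maps it to the vector with coordinates \<open>A, A\<^sup>-\<^sup>1, A\<^sup>-\<^sup>1, A\<close>, which violates
  this relation as soon as \<open>A\<^sup>2 \<noteq> A\<^sup>-\<^sup>2\<close>.  For \<open>A = e\<^sup>i\<^sup>\<theta>\<close> the difference \<open>A\<^sup>2 - A\<^sup>-\<^sup>2\<close> is
  \<open>2 i sin (2 \<theta>)\<close> (lemma \<open>entangling_R_op_cis\<close>).

  Unitarity holds because \<open>R\<close> permutes the basis vectors up to factors of modulus \<open>1\<close>
  (lemma \<open>unitary_R_op\<close>).

  The set of entangling parameters has the cardinality of the continuum by two injections: the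
  argument sends the unit circle injectively into the reals, and every \<open>\<theta>\<close> in the open interval
  from \<open>0\<close> to \<open>\<pi> / 2\<close>, a copy of the real line, gives an entangling parameter.
\<close>

lemma forall_2_01: "(\<forall>i :: 2. P i) \<longleftrightarrow> P 0 \<and> P 1"
  using exhaust_2 by (metis (full_types) forall_2 zero_neq_one)

lemma sum_2_times_2:
  fixes f :: "2 \<times> 2 \<Rightarrow> 'a::comm_monoid_add"
  shows "sum f UNIV = f (0, 0) + f (0, 1) + f (1, 0) + f (1, 1)"
proof -
  have two: "(UNIV :: 2 set) = {0, 1}"
    using exhaust_2 by fastforce
  have U: "(UNIV :: (2 \<times> 2) set) = {(0, 0), (0, 1), (1, 0), (1, 1)}"
    unfolding UNIV_Times_UNIV[symmetric] two by auto
  show ?thesis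
    by (simp add: U add.assoc)
qed

lemma qubit2_eq_iff:
  fixes u v :: qubit2
  shows "u = v \<longleftrightarrow> u $ (0, 0) = v $ (0, 0) \<and> u $ (0, 1) = v $ (0, 1) \<and>
    u $ (1, 0) = v $ (1, 0) \<and> u $ (1, 1) = v $ (1, 1)"
  by (auto simp: vec_eq_iff split_paired_All forall_2_01)

lemma R_op_inverse:
  assumes "A \<noteq> 0"
  shows "R_op A (R_op (inverse A) v) = v"
  using assms by (simp add: qubit2_eq_iff R_op_nth)

lemma unitary_R_op:
  assumes "cmod A = 1"
  shows "unitary_map (R_op A)"
  unfolding unitary_map_def
proof (intro conjI allI)
  show "Vector_Spaces.linear (*s) (*s) (R_op A)"
    by unfold_locales
      (simp_all add: qubit2_eq_iff R_op_nth vector_add_ldistrib vector_sadd_rdistrib algebra_simps)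
  have "A \<noteq> 0"
    using assms by auto
  then show "surj (R_op A)"
    by (metis R_op_inverse surjI)
  fix u v
  have A: "cnj A * A = 1"
    using assms by (metis complex_norm_square mult.commute of_real_1 power_one)
  then have inv: "cnj (inverse A) * inverse A = 1"
    by (metis complex_cnj_inverse inverse_1 inverse_mult_distrib)
  have factor: "cnj (c * x) * (c * y) = cnj x * y" if "cnj c * c = 1" for c x y
  proof -
    have "cnj (c * x) * (c * y) = (cnj c * c) * (cnj x * y)"
      by (simp add: mult_ac)
    then show ?thesis
      using that by simp
  qed
  show "hermitian_inner (R_op A u) (R_op A v) = hermitian_inner u v"
    unfolding hermitian_inner_def sum_2_times_2 R_op_nth factor[OF A] factor[OF inv]
    by (simp add: add_ac)
qed

lemma entangling_R_op:
  assumes "A\<^sup>2 \<noteq> inverse A ^ 2"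
  shows "entangling (R_op A)"
  unfolding entangling_def
proof (intro exI notI)
  \<comment> \<open>The vector \<open>1\<close> has all coordinates \<open>1\<close>, so it is \<open>|0\<rangle> + |1\<rangle>\<close>.\<close>
  assume "\<exists>\<alpha>' \<beta>'. R_op A (tensor 1 1) = tensor \<alpha>' \<beta>'"
  then obtain \<alpha> \<beta> where eq: "R_op A (tensor 1 1) = tensor \<alpha> \<beta>"
    by blast
  have ones: "tensor 1 1 $ p = 1" for p
    by (simp add: tensor_def)
  have prod: "R_op A (tensor 1 1) $ p = \<alpha> $ fst p * \<beta> $ snd p" for p
    unfolding eq by (simp add: tensor_def)
  have coords: "A = \<alpha> $ 0 * \<beta> $ 0" "inverse A = \<alpha> $ 0 * \<beta> $ 1"
      "inverse A = \<alpha> $ 1 * \<beta> $ 0" "A = \<alpha> $ 1 * \<beta> $ 1"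
    using prod[of "(0, 0)"] prod[of "(0, 1)"] prod[of "(1, 0)"] prod[of "(1, 1)"]
    unfolding R_op_nth ones fst_conv snd_conv mult_1_right .
  have "A\<^sup>2 = (\<alpha> $ 0 * \<beta> $ 0) * (\<alpha> $ 1 * \<beta> $ 1)"
    using coords(1,4) by (simp add: power2_eq_square)
  also have "\<dots> = (\<alpha> $ 0 * \<beta> $ 1) * (\<alpha> $ 1 * \<beta> $ 0)"
    by (simp add: mult_ac)
  also have "\<dots> = inverse A ^ 2"
    using coords(2,3) by (simp add: power2_eq_square)
  finally show False
    using assms by contradiction
qed

lemma entangling_R_op_cis:
  assumes "sin (2 * \<theta>) \<noteq> 0"
  shows "entangling (R_op (cis \<theta>))"
proof (rule entangling_R_op)
  have "Im ((cis \<theta>)\<^sup>2) = sin (2 * \<theta>)" "Im (inverse (cis \<theta>) ^ 2) = - sin (2 * \<theta>)"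
    by (simp_all add: cis_inverse power2_eq_square sin_double)
  then show "(cis \<theta>)\<^sup>2 \<noteq> inverse (cis \<theta>) ^ 2"
    using assms by (metis neg_equal_zero)
qed

lemma entangling_parameters_eqpoll:
  "{A. cmod A = 1 \<and> entangling (R_op A)} \<approx> (UNIV :: real set)"
proof (rule lepoll_antisym)
  have "inj_on Arg {A. cmod A = 1 \<and> entangling (R_op A)}"
    by (rule inj_onI) (metis (mono_tags, lifting) cis_Arg mem_Collect_eq norm_zero
        sgn_eq div_by_1 of_real_1 zero_neq_one)
  then show "{A. cmod A = 1 \<and> entangling (R_op A)} \<lesssim> (UNIV :: real set)"
    unfolding lepoll_def by blast
next
  \<comment> \<open>With this angle \<open>sin (2 \<theta>)\<close> becomes \<open>cos (arctan x)\<close>, which is positive.\<close>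
  define \<theta> where "\<theta> x = (arctan x + pi / 2) / 2" for x
  have "Arg (cis (\<theta> x)) = \<theta> x" for x
    using arctan_bounded[of x] by (intro Arg_cis) (auto simp: \<theta>_def)
  then have "inj (\<lambda>x. cis (\<theta> x))"
    by (intro injI) (metis \<theta>_def add_right_cancel arctan_eq_iff divide_cancel_right zero_neq_numeral)
  moreover have "sin (2 * \<theta> x) \<noteq> 0" for x
  proof -
    have "2 * \<theta> x = arctan x + pi / 2"
      by (simp add: \<theta>_def field_simps)
    then have "sin (2 * \<theta> x) = sin (arctan x + pi / 2)"
      by (simp only:)
    also have "\<dots> = cos (arctan x)"
      by (simp only: sin_add cos_pi_half sin_pi_half mult_zero_right mult_1_right add_0)
    finally show ?thesis
      using cos_arctan_not_zero by simp
  qed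
  then have "range (\<lambda>x. cis (\<theta> x)) \<subseteq> {A. cmod A = 1 \<and> entangling (R_op A)}"
    by (auto intro: entangling_R_op_cis)
  ultimately show "(UNIV :: real set) \<lesssim> {A. cmod A = 1 \<and> entangling (R_op A)}"
    unfolding lepoll_def by blast
qed

theorem mainTheorem7:
  shows "(\<forall>\<theta>::real. unitary_map (R_op (exp (\<i> * complex_of_real \<theta>))) \<and>
            (sin (2 * \<theta>) \<noteq> 0 \<longrightarrow> entangling (R_op (exp (\<i> * complex_of_real \<theta>))))) \<and>
         {A::complex. cmod A = 1 \<and> entangling (R_op A)} \<approx> (UNIV :: real set)"
  using unitary_R_op entangling_R_op_cis entangling_parameters_eqpoll
  by (simp flip: cis_conv_exp)

end
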